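(* Let $d\ge 1$ and $n\ge 0$ be integers, and let $\beta\equiv\beta^{(2n)}=\{\beta_{\mathbf i}\in\mathbb R : \mathbf i\in\mathbb Z_+^d,\ |\mathbf i|\le 2n\}$ be a $d$-dimensional truncated moment sequence of degree $2n$ (so $\beta_{\mathbf 0}\ne 0$). Then $\beta$ has an interpolating measure in $\mathbb R^d$; that is, there exists a (not necessarily positive) Borel measure $\mu$ on $\mathbb R^d$ such that $$\beta_{\mathbf i}=\int_{\mathbb R^d}\mathbf x^{\mathbf i}\,d\mu(\mathbf x)\qquad\text{for all }\mathbf i\in\mathbb Z_+^d\text{ with }|\mathbf i|\le 2n .$$
   Context: $\mathbb Z_+$ denotes the nonnegative integers. For $\mathbf i=(i_1,\dots,i_d)\in\mathbb Z_+^d$ and $\mathbf x=(x_1,\dots,x_d)\in\mathbb R^d$, $|\mathbf i|=i_1+\cdots+i_d$ and $\mathbf x^{\mathbf i}=x_1^{i_1}\cdots x_d^{i_d}$. A $d$-dimensional truncated moment sequence of degree $m$ is a family of real numbers $\{\beta_{\mathbf i}: \mathbf i\in\mathbb Z_+^d,\ |\mathbf i|\le m\}$ with $\beta_{\mathbf 0}\neq 0$. An interpolating measure for it is a signed (i.e. not necessarily positive) Borel measure $\mu$ on $\mathbb R^d$, with respect to which all the monomials $\mathbf x^{\mathbf i}$ involved are integrable, such that $\beta_{\mathbf i}=\int\mathbf x^{\mathbf i}\,d\mu$ for all $\mathbf i$ in the index set. *)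

theory Defs
  imports "HOL-Analysis.Analysis"
begin

(* Multi-indices in Z_+^d are vectors i :: nat ^ 'd, where d = CARD('d). *)

definition multi_degree :: "nat ^ 'd \<Rightarrow> nat" where
  "multi_degree i = (\<Sum>j\<in>UNIV. i $ j)"

definition monomial :: "nat ^ 'd \<Rightarrow> real ^ 'd \<Rightarrow> real" where
  "monomial i x = (\<Prod>j\<in>UNIV. (x $ j) ^ (i $ j))"

(* Signed measures on the sigma-algebra of M (only space M and sets M matter, not the measure
   carried by M). They are real-valued: a signed measure with values in the extended reals
   for which the constant function 1 = x^0 is integrable takes only finite values. *)

definition signed_measure :: "'a measure \<Rightarrow> ('a set \<Rightarrow> real) \<Rightarrow> bool" where
  "signed_measure M \<nu> \<longleftrightarrow>
     \<nu> {} = 0 \<and>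
     (\<forall>A :: nat \<Rightarrow> 'a set. range A \<subseteq> sets M \<longrightarrow> disjoint_family A \<longrightarrow>
        (\<lambda>k. \<nu> (A k)) sums \<nu> (\<Union>k. A k))"

(* Jordan decomposition: the upper variation of nu at A is the supremum of nu B over the
   measurable B contained in A, and the lower variation is the upper variation of - nu.
   The map ennreal sends negative reals to 0; this does not change the supremum, since
   B = {} contributes 0. The lemma emeasure_upper_variation below shows that measure_of is
   applied to a genuine measure, so that it does not return the null measure by default. *)

definition upper_variation :: "'a measure \<Rightarrow> ('a set \<Rightarrow> real) \<Rightarrow> 'a measure" where
  "upper_variation M \<nu> =
     measure_of (space M) (sets M) (\<lambda>A. SUP B\<in>{B \<in> sets M. B \<subseteq> A}. ennreal (\<nu> B))"

definition lower_variation :: "'a measure \<Rightarrow> ('a set \<Rightarrow> real) \<Rightarrow> 'a measure" where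
  "lower_variation M \<nu> = upper_variation M (\<lambda>A. - \<nu> A)"

definition signed_integrable :: "'a measure \<Rightarrow> ('a set \<Rightarrow> real) \<Rightarrow> ('a \<Rightarrow> real) \<Rightarrow> bool" where
  "signed_integrable M \<nu> f \<longleftrightarrow>
     integrable (upper_variation M \<nu>) f \<and> integrable (lower_variation M \<nu>) f"

definition signed_integral :: "'a measure \<Rightarrow> ('a set \<Rightarrow> real) \<Rightarrow> ('a \<Rightarrow> real) \<Rightarrow> real" where
  "signed_integral M \<nu> f =
     integral\<^sup>L (upper_variation M \<nu>) f - integral\<^sup>L (lower_variation M \<nu>) f"

(* The values of beta at multi-indices of degree greater than m are irrelevant. *)

definition interpolating_measure ::
    "nat \<Rightarrow> (nat ^ 'd \<Rightarrow> real) \<Rightarrow> ((real ^ 'd) set \<Rightarrow> real) \<Rightarrow> bool" where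
  "interpolating_measure m \<beta> \<mu> \<longleftrightarrow>
     signed_measure borel \<mu> \<and>
     (\<forall>i. multi_degree i \<le> m \<longrightarrow>
        signed_integrable borel \<mu> (monomial i) \<and>
        \<beta> i = signed_integral borel \<mu> (monomial i))"

lemma sets_upper_variation [simp]: "sets (upper_variation M \<nu>) = sets M"
  by (simp add: upper_variation_def)

lemma space_upper_variation [simp]: "space (upper_variation M \<nu>) = space M"
  by (simp add: upper_variation_def)

lemma signed_measure_Un:
  assumes "signed_measure M \<nu>" "A \<in> sets M" "B \<in> sets M" "A \<inter> B = {}"
  shows "\<nu> (A \<union> B) = \<nu> A + \<nu> B"
proof -
  have "disjoint_family (binaryset A B)"
    using assms(4) by (auto simp: disjoint_family_on_def binaryset_def)
  moreover have "range (binaryset A B) \<subseteq> sets M"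
    using assms by (auto simp: range_binaryset_eq)
  ultimately have "(\<lambda>k. \<nu> (binaryset A B k)) sums \<nu> (\<Union>k. binaryset A B k)"
    using assms(1) unfolding signed_measure_def by blast
  moreover have "(\<lambda>k. \<nu> (binaryset A B k)) sums (\<nu> A + \<nu> B)"
    using assms(1) by (intro binaryset_sums) (simp add: signed_measure_def)
  ultimately show ?thesis
    by (metis UN_binaryset_eq sums_unique2)
qed

lemma emeasure_upper_variation:
  assumes sm: "signed_measure M \<nu>" and A: "A \<in> sets M"
  shows "emeasure (upper_variation M \<nu>) A = (SUP B\<in>{B \<in> sets M. B \<subseteq> A}. ennreal (\<nu> B))"
proof -
  define P where "P = (\<lambda>A. SUP B\<in>{B \<in> sets M. B \<subseteq> A}. ennreal (\<nu> B))"
  have P_eq: "P A = (SUP B\<in>{B \<in> sets M. B \<subseteq> A}. ennreal (\<nu> B))" for A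
    by (simp add: P_def)
  have nu0: "\<nu> {} = 0" using sm by (simp add: signed_measure_def)
  have ub: "ennreal (\<nu> B) \<le> P A" if "B \<in> sets M" "B \<subseteq> A" for A B
    unfolding P_def using that by (intro SUP_upper) auto
  have mono: "P A \<le> P B" if "A \<subseteq> B" for A B
    unfolding P_def using that by (intro SUP_subset_mono) auto
  have super: "P A + P B \<le> P (A \<union> B)" if AB: "A \<inter> B = {}" for A B
  proof -
    have "ennreal (\<nu> C) + ennreal (\<nu> D) \<le> P (A \<union> B)"
      if C: "C \<in> sets M" "C \<subseteq> A" and D: "D \<in> sets M" "D \<subseteq> B" for C D
    proof -
      have un: "\<nu> (C \<union> D) = \<nu> C + \<nu> D"
        using C D AB by (intro signed_measure_Un[OF sm]) auto
      consider "\<nu> C \<ge> 0" "\<nu> D \<ge> 0" | "\<nu> C \<le> 0" | "\<nu> D \<le> 0" by linarith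
      then show ?thesis
      proof cases
        case 1
        then have "ennreal (\<nu> C) + ennreal (\<nu> D) = ennreal (\<nu> (C \<union> D))"
          by (simp add: un)
        also have "\<dots> \<le> P (A \<union> B)" using C D by (intro ub) auto
        finally show ?thesis .
      next
        case 2
        moreover have "ennreal (\<nu> D) \<le> P (A \<union> B)" using D by (intro ub) auto
        ultimately show ?thesis by (simp add: ennreal_neg)
      next
        case 3
        moreover have "ennreal (\<nu> C) \<le> P (A \<union> B)" using C by (intro ub) auto
        ultimately show ?thesis by (simp add: ennreal_neg)
      qed
    qed
    then have "(SUP C\<in>{C \<in> sets M. C \<subseteq> A}. ennreal (\<nu> C) + ennreal (\<nu> D)) \<le> P (A \<union> B)"
      if "D \<in> sets M" "D \<subseteq> B" for D
      using that by (intro SUP_least) auto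
    moreover have "P A + ennreal (\<nu> D) =
        (SUP C\<in>{C \<in> sets M. C \<subseteq> A}. ennreal (\<nu> C) + ennreal (\<nu> D))" for D
      unfolding P_eq[of A] by (intro ennreal_SUP_add_left[symmetric]) auto
    ultimately have "(SUP D\<in>{D \<in> sets M. D \<subseteq> B}. P A + ennreal (\<nu> D)) \<le> P (A \<union> B)"
      by (intro SUP_least) auto
    moreover have "P A + P B = (SUP D\<in>{D \<in> sets M. D \<subseteq> B}. P A + ennreal (\<nu> D))"
      unfolding P_eq[of B] by (intro ennreal_SUP_add_right) auto
    ultimately show ?thesis by simp
  qed
  have fin: "(\<Sum>k<n. P (F k)) \<le> P (\<Union>k<n. F k)"
    if "disjoint_family F" for F :: "nat \<Rightarrow> 'a set" and n
  proof (induction n)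
    case 0
    show ?case by simp
  next
    case (Suc n)
    have "(\<Sum>k<Suc n. P (F k)) \<le> P (\<Union>k<n. F k) + P (F n)"
      using Suc by (simp add: add_right_mono)
    moreover have "F k \<inter> F n = {}" if "k < n" for k
      using \<open>disjoint_family F\<close> that by (simp add: disjoint_family_on_def)
    then have "P (\<Union>k<n. F k) + P (F n) \<le> P ((\<Union>k<n. F k) \<union> F n)"
      by (intro super) blast
    moreover have "(\<Union>k<n. F k) \<union> F n = (\<Union>k<Suc n. F k)"
      by (auto simp: less_Suc_eq)
    ultimately show ?case by (metis order_trans)
  qed
  have "countably_additive (sets M) P"
  proof (rule countably_additiveI)
    fix F :: "nat \<Rightarrow> 'a set"
    assume F: "range F \<subseteq> sets M" "disjoint_family F"
    show "(\<Sum>k. P (F k)) = P (\<Union>k. F k)"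
    proof (rule antisym)
      show "(\<Sum>k. P (F k)) \<le> P (\<Union>k. F k)"
      proof (rule suminf_le_const)
        show "(\<Sum>k<n. P (F k)) \<le> P (\<Union>k. F k)" for n
          using fin[OF F(2), of n] mono[of "\<Union>k<n. F k" "\<Union>k. F k"] by (auto intro: order_trans)
      qed simp
      show "P (\<Union>k. F k) \<le> (\<Sum>k. P (F k))"
        unfolding P_eq[of "\<Union>k. F k"]
      proof (rule SUP_least)
        fix B assume B: "B \<in> {B \<in> sets M. B \<subseteq> (\<Union>k. F k)}"
        let ?G = "\<lambda>k. B \<inter> F k"
        have "range ?G \<subseteq> sets M" "disjoint_family ?G"
          using B F by (auto simp: disjoint_family_on_def)
        then have "(\<lambda>k. \<nu> (?G k)) sums \<nu> (\<Union>k. ?G k)"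
          using sm unfolding signed_measure_def by blast
        moreover have "(\<Union>k. ?G k) = B" using B by auto
        ultimately have lim: "(\<lambda>n. \<Sum>k<n. \<nu> (?G k)) \<longlonglongrightarrow> \<nu> B"
          by (simp add: sums_def)
        have "ennreal (\<Sum>k<n. \<nu> (?G k)) \<le> (\<Sum>k. P (F k))" for n
        proof -
          have "ennreal (\<Sum>k<n. \<nu> (?G k)) \<le> ennreal (\<Sum>k<n. max 0 (\<nu> (?G k)))"
            by (intro ennreal_leI sum_mono) auto
          also have "\<dots> = (\<Sum>k<n. ennreal (max 0 (\<nu> (?G k))))"
            by (simp add: sum_ennreal)
          also have "\<dots> \<le> (\<Sum>k<n. P (F k))"
            using B F by (intro sum_mono) (auto simp: max_def ennreal_neg intro!: ub)
          also have "\<dots> \<le> (\<Sum>k. P (F k))"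
            by (intro sum_le_suminf) auto
          finally show ?thesis .
        qed
        moreover have "(\<lambda>n. ennreal (\<Sum>k<n. \<nu> (?G k))) \<longlonglongrightarrow> ennreal (\<nu> B)"
          using lim by (rule tendsto_ennrealI)
        ultimately show "ennreal (\<nu> B) \<le> (\<Sum>k. P (F k))"
          by (intro LIMSEQ_le_const2) auto
      qed
    qed
  qed
  moreover have "{B \<in> sets M. B = {}} = {{}}" by auto
  then have "positive (sets M) P"
    by (simp add: positive_def P_def nu0)
  ultimately show ?thesis
    unfolding upper_variation_def P_def[symmetric] P_eq[symmetric]
    using A by (intro emeasure_measure_of_sigma) (auto simp: sets.sigma_algebra_axioms)
qed

end

theory Submission
  imports Defs "HOL-Computational_Algebra.Polynomial"
begin

text \<open>
  A measure carried by finitely many points is enough, and since its weights may have either sign,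
  it can be found by linear algebra alone. In one variable, let \<open>X\<close> be a set of more than \<open>m\<close> real
  nodes. Lagrange interpolation reproduces every polynomial of degree at most \<open>m\<close> from its values
  on \<open>X\<close>; applied to \<open>x ^ l\<close>, this says that on these polynomials the functional giving the
  \<open>k\<close>-th coefficient is integration against the measure with mass \<open>coeff (lagrange_basis X a) k\<close> at each
  node \<open>a\<close> (lemma \<open>sum_coeff_lagrange_basis\<close>).

  In \<open>d\<close> variables, products of these masses on the grid \<open>X\<^sup>d\<close> give measures dual to the monomials
  (lemma \<open>sum_grid_dual_monomial\<close>). The combination of these measures with coefficients \<open>\<beta> i\<close> has
  the prescribed moments. Integrals against a signed measure are defined through its Jordan
  decomposition, which for finitely many atoms just separates the positive from the negative
  weights (lemma \<open>upper_variation_atomic\<close>).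
\<close>

section \<open>Coefficient functionals in one variable\<close>

definition lagrange_basis :: "'a::field set \<Rightarrow> 'a \<Rightarrow> 'a poly" where
  "lagrange_basis X a = smult (inverse (\<Prod>b\<in>X - {a}. a - b)) (\<Prod>b\<in>X - {a}. [:- b, 1:])"

lemma poly_lagrange_basis:
  assumes "finite X" "a \<in> X" "b \<in> X"
  shows "poly (lagrange_basis X a) b = (if a = b then 1 else 0)"
  using assms by (auto simp: lagrange_basis_def poly_prod)

lemma degree_lagrange_basis:
  assumes "finite X" "a \<in> X"
  shows "degree (lagrange_basis X a) < card X"
proof -
  have "degree (\<Prod>b\<in>X - {a}. [:- b, 1:]) \<le> card (X - {a})"
    using degree_prod_sum_le[of "X - {a}" "\<lambda>b. [:- b, 1:]"] assms by simp
  also have "\<dots> < card X"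
    using assms by (rule card_Diff1_less)
  finally show ?thesis
    using degree_smult_le order_le_less_trans unfolding lagrange_basis_def by blast
qed

text \<open>
  The interpolation polynomial of \<open>x ^ l\<close> on the nodes is \<open>x ^ l\<close> itself, because both have degree
  less than the number of nodes; the claim compares the coefficients of \<open>x ^ k\<close>. In other words,
  the coefficients of the Lagrange basis form the inverse of the Vandermonde matrix of \<open>X\<close>.
\<close>

lemma sum_coeff_lagrange_basis:
  fixes X :: "'a::field set"
  assumes "finite X" "l < card X"
  shows "(\<Sum>a\<in>X. coeff (lagrange_basis X a) k * a ^ l) = (if k = l then 1 else 0)"
proof -
  have "(\<Sum>a\<in>X. smult (a ^ l) (lagrange_basis X a)) = monom 1 l"
  proof (rule poly_eqI_degree)
    fix b assume "b \<in> X"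
    then have "(\<Sum>a\<in>X. a ^ l * poly (lagrange_basis X a) b) = (\<Sum>a\<in>X. if a = b then a ^ l else 0)"
      using assms(1) by (intro sum.cong) (auto simp: poly_lagrange_basis)
    also have "\<dots> = b ^ l"
      using \<open>b \<in> X\<close> assms(1) by simp
    finally show "poly (\<Sum>a\<in>X. smult (a ^ l) (lagrange_basis X a)) b = poly (monom 1 l) b"
      by (simp add: poly_sum poly_monom)
  next
    have "degree (smult (a ^ l) (lagrange_basis X a)) < card X" if "a \<in> X" for a
      using degree_lagrange_basis[OF assms(1) that] degree_smult_le order_le_less_trans by blast
    then show "degree (\<Sum>a\<in>X. smult (a ^ l) (lagrange_basis X a)) < card X"
      using assms by (intro degree_sum_less) auto
  next
    show "degree (monom 1 l :: 'a poly) < card X"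
      using assms(2) by (simp add: degree_monom_eq)
  qed
  from arg_cong[OF this, of "\<lambda>p. coeff p k"] show ?thesis
    by (simp add: coeff_sum mult.commute)
qed

section \<open>Products on a grid\<close>

definition grid :: "'a set \<Rightarrow> ('a ^ 'd) set" where
  "grid A = {v. \<forall>j. v $ j \<in> A}"

lemma grid_eq_image: "grid A = vec_lambda ` (UNIV \<rightarrow>\<^sub>E A)"
proof -
  have "v \<in> vec_lambda ` (UNIV \<rightarrow>\<^sub>E A)" if "v \<in> grid A" for v :: "'a ^ 'd"
    using that by (intro image_eqI[of _ _ "\<lambda>j. v $ j"]) (auto simp: grid_def)
  then show ?thesis
    by (auto simp: grid_def)
qed

lemma finite_grid: "finite A \<Longrightarrow> finite (grid A)"
  by (simp add: grid_eq_image finite_PiE)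

lemma sum_grid_prod:
  fixes f :: "'d::finite \<Rightarrow> 'a \<Rightarrow> 'b::comm_semiring_1"
  assumes "finite A"
  shows "(\<Sum>v\<in>grid A. \<Prod>j\<in>UNIV. f j (v $ j)) = (\<Prod>j\<in>UNIV. \<Sum>a\<in>A. f j a)"
proof -
  have "inj_on (vec_lambda :: ('d \<Rightarrow> 'a) \<Rightarrow> _) (UNIV \<rightarrow>\<^sub>E A)"
    by (auto simp: inj_on_def vec_lambda_inject)
  then have "(\<Sum>v\<in>grid A. \<Prod>j\<in>UNIV. f j (v $ j)) = (\<Sum>g\<in>UNIV \<rightarrow>\<^sub>E A. \<Prod>j\<in>UNIV. f j (g j))"
    by (simp add: grid_eq_image sum.reindex)
  also have "\<dots> = (\<Prod>j\<in>UNIV. \<Sum>a\<in>A. f j a)"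
    using assms by (simp add: prod_sum_PiE)
  finally show ?thesis .
qed

text \<open>
  The \<open>d\<close>-fold product of the one-variable functionals extracts the coefficient of \<open>x\<^sup>i\<close> from
  every polynomial whose degree in each single variable is below the number of nodes.
\<close>

lemma sum_grid_dual_monomial:
  fixes X :: "real set" and i k :: "nat ^ 'd"
  assumes "finite X" "\<And>j. k $ j < card X"
  shows "(\<Sum>v\<in>grid X. (\<Prod>j\<in>UNIV. coeff (lagrange_basis X (v $ j)) (i $ j)) * monomial k v) =
    (if i = k then 1 else 0)"
proof -
  have "(\<Sum>v\<in>grid X. (\<Prod>j\<in>UNIV. coeff (lagrange_basis X (v $ j)) (i $ j)) * monomial k v) =
      (\<Sum>v\<in>grid X. \<Prod>j\<in>UNIV. coeff (lagrange_basis X (v $ j)) (i $ j) * v $ j ^ (k $ j))"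
    by (simp add: monomial_def prod.distrib)
  also have "\<dots> = (\<Prod>j\<in>UNIV. \<Sum>a\<in>X. coeff (lagrange_basis X a) (i $ j) * a ^ (k $ j))"
    using sum_grid_prod[OF assms(1), of "\<lambda>j a. coeff (lagrange_basis X a) (i $ j) * a ^ (k $ j)"] .
  also have "\<dots> = (\<Prod>j\<in>UNIV. if i $ j = k $ j then 1 else 0)"
    using assms by (simp add: sum_coeff_lagrange_basis)
  also have "\<dots> = (if i = k then 1 else 0)"
    by (auto simp: vec_eq_iff)
  finally show ?thesis .
qed

section \<open>Signed measures with finitely many atoms\<close>

definition atomic :: "'a set \<Rightarrow> ('a \<Rightarrow> real) \<Rightarrow> 'a set \<Rightarrow> real" where
  "atomic S c A = (\<Sum>s\<in>S. c s * indicator A s)"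

lemma atomic_uminus: "atomic S (\<lambda>s. - c s) A = - atomic S c A"
  by (simp add: atomic_def sum_negf)

lemma atomic_eq_sum: "finite S \<Longrightarrow> atomic S c A = sum c (S \<inter> A)"
  by (simp add: atomic_def sum.inter_restrict indicator_def of_bool_def if_distrib cong: if_cong)

lemma signed_measure_atomic: "signed_measure M (atomic S c)"
  unfolding signed_measure_def atomic_def
proof (intro conjI allI impI)
  fix A :: "nat \<Rightarrow> 'a set"
  assume "disjoint_family A"
  then have "(\<lambda>k. indicator (A k) s :: real) sums indicator (\<Union>k. A k) s" for s
    by (intro indicator_sums) (auto simp: disjoint_family_on_def)
  then show "(\<lambda>k. \<Sum>s\<in>S. c s * indicator (A k) s) sums (\<Sum>s\<in>S. c s * indicator (\<Union>k. A k) s)"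
    by (intro sums_sum sums_mult)
qed simp

text \<open>
  Among the subsets of \<open>A\<close>, the set of atoms of positive weight in \<open>A\<close> has the greatest mass, so
  the upper variation keeps exactly the positive weights. Singletons are closed in a \<open>T\<^sub>1\<close> space,
  which makes this finite set of atoms a Borel set.
\<close>

lemma upper_variation_atomic:
  fixes S :: "'a::t1_space set"
  assumes S: "finite S"
  shows "upper_variation borel (atomic S c) =
    distr (point_measure S (\<lambda>s. max 0 (c s))) borel (\<lambda>s. s)"
proof (rule measure_eqI)
  fix A assume "A \<in> sets (upper_variation borel (atomic S c))"
  then have A: "A \<in> sets borel" by simp
  define P where "P = {s \<in> S \<inter> A. c s > 0}"
  let ?m = "\<Sum>s\<in>S \<inter> A. max 0 (c s)"
  have "finite P" using S by (simp add: P_def)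
  then have P: "P \<in> sets borel" "P \<subseteq> A"
    by (auto simp: P_def intro!: borel_closed finite_imp_closed)
  have "S \<inter> P = P" by (auto simp: P_def)
  then have "atomic S c P = sum c P"
    using S by (simp add: atomic_eq_sum)
  also have "\<dots> = (\<Sum>s\<in>P. max 0 (c s))"
    by (intro sum.cong) (auto simp: P_def)
  also have "\<dots> = ?m"
    using S by (intro sum.mono_neutral_left) (auto simp: P_def)
  finally have P_max: "atomic S c P = ?m" .
  have "atomic S c B \<le> ?m" if "B \<subseteq> A" for B
  proof -
    have "atomic S c B \<le> (\<Sum>s\<in>S \<inter> B. max 0 (c s))"
      using S by (simp add: atomic_eq_sum sum_mono)
    also have "\<dots> \<le> ?m"
      using S that by (intro sum_mono2) auto
    finally show ?thesis .
  qed
  then have "(SUP B\<in>{B \<in> sets borel. B \<subseteq> A}. ennreal (atomic S c B)) = ennreal ?m"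
    using P P_max by (intro antisym SUP_least SUP_upper2[of P]) (auto intro: ennreal_leI)
  then have "emeasure (upper_variation borel (atomic S c)) A = ennreal ?m"
    using emeasure_upper_variation[OF signed_measure_atomic A] by metis
  also have "\<dots> = emeasure (point_measure S (\<lambda>s. max 0 (c s))) (S \<inter> A)"
    using S by (simp add: emeasure_point_measure_finite sum_ennreal)
  also have "\<dots> = emeasure (distr (point_measure S (\<lambda>s. max 0 (c s))) borel (\<lambda>s. s)) A"
    using A by (simp add: emeasure_distr space_point_measure Int_commute)
  finally show "emeasure (upper_variation borel (atomic S c)) A =
      emeasure (distr (point_measure S (\<lambda>s. max 0 (c s))) borel (\<lambda>s. s)) A" .
qed simp

lemma
  fixes S :: "'a::t1_space set" and f :: "'a \<Rightarrow> real"
  assumes "finite S" "f \<in> borel_measurable borel"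
  shows integrable_upper_variation_atomic:
      "integrable (upper_variation borel (atomic S c)) f"
    and integral_upper_variation_atomic:
      "integral\<^sup>L (upper_variation borel (atomic S c)) f = (\<Sum>s\<in>S. max 0 (c s) * f s)"
  using assms
  by (simp_all add: upper_variation_atomic integrable_distr_eq integral_distr
      integrable_point_measure_finite lebesgue_integral_point_measure_finite)

lemma lower_variation_atomic:
  "lower_variation M (atomic S c) = upper_variation M (atomic S (\<lambda>s. - c s))"
  by (simp add: lower_variation_def flip: atomic_uminus)

lemma
  fixes S :: "'a::t1_space set"
  assumes "finite S" "f \<in> borel_measurable borel"
  shows signed_integrable_atomic: "signed_integrable borel (atomic S c) f"
    and signed_integral_atomic: "signed_integral borel (atomic S c) f = (\<Sum>s\<in>S. c s * f s)"
proof -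
  show "signed_integrable borel (atomic S c) f"
    using assms
    by (simp add: signed_integrable_def lower_variation_atomic integrable_upper_variation_atomic)
  have "max 0 (c s) * f s - max 0 (- c s) * f s = c s * f s" for s
    by (simp add: max_def)
  then show "signed_integral borel (atomic S c) f = (\<Sum>s\<in>S. c s * f s)"
    using assms
    by (simp add: signed_integral_def lower_variation_atomic integral_upper_variation_atomic
        flip: sum_subtractf)
qed

section \<open>The interpolating measure\<close>

lemma borel_measurable_monomial: "monomial i \<in> borel_measurable borel"
  unfolding monomial_def by measurable

lemma component_le_multi_degree: "i $ j \<le> multi_degree i"
  unfolding multi_degree_def by (rule member_le_sum) auto

text \<open>
  The nodes \<open>0, \<dots>, m\<close> serve as well as any other \<open>m + 1\<close> reals. The moment problem is solved for
  all multi-indices with entries at most \<open>m\<close>, among which are those of degree at most \<open>m\<close>.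
\<close>

lemma ex_interpolating_measure:
  fixes \<beta> :: "nat ^ 'd \<Rightarrow> real"
  shows "\<exists>\<mu>. interpolating_measure m \<beta> \<mu>"
proof -
  define X where "X = real ` {..m}"
  define w where "w i v = (\<Prod>j\<in>UNIV. coeff (lagrange_basis X (v $ j)) (i $ j))"
    for i :: "nat ^ 'd" and v :: "real ^ 'd"
  define c where "c v = (\<Sum>i\<in>grid {..m}. \<beta> i * w i v)" for v
  have X: "finite X" "card X = Suc m"
    by (simp_all add: X_def card_image)
  have "(\<Sum>v\<in>grid X. c v * monomial k v) = \<beta> k" if "multi_degree k \<le> m" for k
  proof -
    have le: "k $ j \<le> m" for j
      using component_le_multi_degree that by (rule order_trans)
    then have dual: "(\<Sum>v\<in>grid X. w i v * monomial k v) = (if i = k then 1 else 0)" for i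
      unfolding w_def using X by (intro sum_grid_dual_monomial) (auto simp: less_Suc_eq_le)
    have "(\<Sum>v\<in>grid X. c v * monomial k v) =
        (\<Sum>v\<in>grid X. \<Sum>i\<in>grid {..m}. \<beta> i * (w i v * monomial k v))"
      by (simp add: c_def sum_distrib_right mult.assoc)
    also have "\<dots> = (\<Sum>i\<in>grid {..m}. \<beta> i * (\<Sum>v\<in>grid X. w i v * monomial k v))"
      by (subst sum.swap) (simp add: sum_distrib_left)
    also have "\<dots> = (\<Sum>i\<in>grid {..m}. if i = k then \<beta> i else 0)"
      by (intro sum.cong) (auto simp: dual)
    also have "\<dots> = \<beta> k"
      using le by (simp add: finite_grid) (simp add: grid_def)
    finally show ?thesis .
  qed
  then have "interpolating_measure m \<beta> (atomic (grid X) c)"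
    using X by (simp add: interpolating_measure_def signed_measure_atomic finite_grid
        signed_integrable_atomic signed_integral_atomic borel_measurable_monomial)
  then show ?thesis by blast
qed

theorem theorem3p4:
  fixes n :: nat and \<beta> :: "nat ^ 'd \<Rightarrow> real"
  assumes "\<beta> 0 \<noteq> 0"
  shows "\<exists>\<mu> :: (real ^ 'd) set \<Rightarrow> real. interpolating_measure (2 * n) \<beta> \<mu>"
  by (rule ex_interpolating_measure)

end
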